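(* Let $m>0$ and $M\ge 0$ be real numbers, and let $$C^{3,2}_{M,m}[0,1]=\{f:[0,1]\to\mathbb{R} : f\in C^{3}[0,1],\ \|f'''\|\le M,\ |f''(x)|\ge m \text{ for all } x\in[0,1]\}.$$ Then for all $f\in C^{3,2}_{M,m}[0,1]$ and all $n\in\mathbb{N}$ with $n\ge n_{1}$, where $n_{1}=\left[\frac{1024M^{2}}{m^{2}}\right]+1$, we have $$\frac{1}{64}\cdot\omega^{2}_{\varphi}\left(f,\frac{1}{\sqrt{n}}\right)\le\|f-B_nf\|\le 3\,\omega^{2}_{\varphi}\left(f,\frac{1}{\sqrt{n}}\right).$$
   Context: $\mathbb{N}=\{1,2,3,\dots\}$, and $[a]$ denotes the integer part of $a$. $C^{3}[0,1]$ is the set of three times continuously differentiable functions $f:[0,1]\to\mathbb{R}$. $\|\cdot\|$ denotes the uniform norm on $C[0,1]$. For $f\in C[0,1]$ and $n\in\mathbb{N}$, the Bernstein polynomial is $B_nf(x)=B_n(f;x)=\sum_{k=0}^{n}f\left(\frac{k}{n}\right)\binom{n}{k}x^{k}(1-x)^{n-k}$, $x\in[0,1]$. Let $\varphi(x)=\sqrt{x(1-x)}$. The second order Ditzian-Totik modulus of smoothness $\omega^{2}_{\varphi}(f,\delta)$ (the superscript $2$ denotes the order, not a square) is $$\omega^{2}_{\varphi}(f,\delta)=\sup_{0\le h\le\delta}\ \sup\left\{|f(x+h\varphi(x))-2f(x)+f(x-h\varphi(x))| : x\in\left[\tfrac{h^{2}}{1+h^{2}},\tfrac{1}{1+h^{2}}\right]\right\},\qquad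 0\le\delta\le 1.$$ (The condition on $x$ is exactly that $x\pm h\varphi(x)\in[0,1]$.) *)

theory Defs
  imports "HOL-Analysis.Analysis"
begin

text \<open>
  A function on \<open>[0,1]\<close> is represented by a total function of type \<^typ>\<open>real \<Rightarrow> real\<close>; all notions
  below depend only on its values on \<open>{0..1}\<close>. Derivatives are taken within \<open>{0..1}\<close>, hence are
  one-sided at the endpoints.
\<close>

definition nth_deriv01 :: "nat \<Rightarrow> (real \<Rightarrow> real) \<Rightarrow> real \<Rightarrow> real" where
  "nth_deriv01 k f = ((\<lambda>g x. vector_derivative g (at x within {0..1})) ^^ k) f"

definition Ck01 :: "nat \<Rightarrow> (real \<Rightarrow> real) set" where
  "Ck01 k = {f. (\<forall>j<k. nth_deriv01 j f differentiable_on {0..1}) \<and>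
                continuous_on {0..1} (nth_deriv01 k f)}"

text \<open>
  The suprema below are taken in \<^typ>\<open>real\<close> and are meaningful only for nonempty sets that are
  bounded above; this is the case for functions continuous on \<open>{0..1}\<close> and \<open>0 \<le> \<delta> \<le> 1\<close>.
\<close>

definition unif_norm :: "(real \<Rightarrow> real) \<Rightarrow> real" where
  "unif_norm f = (SUP x\<in>{0..1}. \<bar>f x\<bar>)"

definition bernstein_op :: "nat \<Rightarrow> (real \<Rightarrow> real) \<Rightarrow> real \<Rightarrow> real" where
  "bernstein_op n f x = (\<Sum>k\<le>n. f (real k / real n) * Bernstein n k x)"

definition phi :: "real \<Rightarrow> real" where
  "phi x = sqrt (x * (1 - x))"

definition omega2_phi :: "(real \<Rightarrow> real) \<Rightarrow> real \<Rightarrow> real" where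
  "omega2_phi f \<delta> = (SUP h\<in>{0..\<delta>}. SUP x\<in>{h\<^sup>2 / (1 + h\<^sup>2)..1 / (1 + h\<^sup>2)}.
     \<bar>f (x + h * phi x) - 2 * f x + f (x - h * phi x)\<bar>)"

definition C32 :: "real \<Rightarrow> real \<Rightarrow> (real \<Rightarrow> real) set" where
  "C32 M m = {f \<in> Ck01 3. unif_norm (nth_deriv01 3 f) \<le> M \<and>
                          (\<forall>x\<in>{0..1}. \<bar>nth_deriv01 2 f x\<bar> \<ge> m)}"

end

theory Submission
  imports Defs
begin

text \<open>
  With \<open>q = x (1 - x)\<close>, Taylor's formula shows that \<open>\<bar>f - B\<^sub>n f\<bar>\<close> at \<open>x\<close> is \<open>q \<bar>f''\<bar> / (2 n)\<close> and the
  second difference with step \<open>h \<phi>(x)\<close> is \<open>h\<^sup>2 q \<bar>f''\<bar>\<close>, both up to errors of order \<open>M q n\<^bsup>-3/2\<^esup>\<close>.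
  The condition on \<open>n\<close> says \<open>32 M \<le> m sqrt n\<close>, so these errors are small relative to \<open>q \<bar>f''\<bar> / n\<close>
  and the two quantities can be compared pointwise. Points outside the interval over which the
  modulus with \<open>h = 1 / sqrt n\<close> is taken are moved to its nearest endpoint: this increases \<open>q\<close> and
  changes \<open>f''\<close> by at most \<open>M / n \<le> m / 32\<close>.
\<close>

section \<open>Central moments of the Bernstein basis\<close>

text \<open>Pascal's rule. For indices beyond the degree the binomial coefficient vanishes, which
  makes up for the truncated subtraction in the exponent.\<close>

lemma Bernstein_Suc_Suc:
  "Bernstein (Suc n) (Suc k) x = x * Bernstein n k x + (1 - x) * Bernstein n (Suc k) x"
proof (cases "Suc k \<le> n")
  case True
  then have "n - k = Suc (n - Suc k)" by simp
  then show ?thesis by (simp add: Bernstein_def algebra_simps)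
next
  case False
  then show ?thesis by (cases "n = k") (auto simp: Bernstein_def binomial_eq_0)
qed

text \<open>For \<open>x\<close> in [0,1] this is the expectation of \<open>g\<close> at a binomial
  variable with \<open>Suc n\<close> trials, conditioned on one trial: success, with probability
  \<open>x\<close>, shifts the argument by one.\<close>

lemma sum_Bernstein_Suc:
  "(\<Sum>k\<le>Suc n. g k * Bernstein (Suc n) k x) =
     x * (\<Sum>k\<le>n. g (Suc k) * Bernstein n k x) + (1 - x) * (\<Sum>k\<le>n. g k * Bernstein n k x)"
proof -
  have "(\<Sum>k\<le>Suc n. g k * Bernstein (Suc n) k x) =
      g 0 * Bernstein (Suc n) 0 x + (\<Sum>k\<le>n. g (Suc k) * Bernstein (Suc n) (Suc k) x)"
    by (rule sum.atMost_Suc_shift)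
  also have "\<dots> = x * (\<Sum>k\<le>n. g (Suc k) * Bernstein n k x) +
      (1 - x) * (g 0 * Bernstein n 0 x + (\<Sum>k\<le>n. g (Suc k) * Bernstein n (Suc k) x))"
  proof -
    have "g 0 * Bernstein (Suc n) 0 x = (1 - x) * (g 0 * Bernstein n 0 x)"
      by (simp add: Bernstein_def)
    moreover have "(\<Sum>k\<le>n. g (Suc k) * Bernstein (Suc n) (Suc k) x) =
        x * (\<Sum>k\<le>n. g (Suc k) * Bernstein n k x) +
        (1 - x) * (\<Sum>k\<le>n. g (Suc k) * Bernstein n (Suc k) x)"
      unfolding Bernstein_Suc_Suc sum_distrib_left sum.distrib [symmetric]
      by (intro sum.cong refl) (simp add: distrib_left mult_ac)
    ultimately show ?thesis by (simp add: distrib_left)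
  qed
  also have "g 0 * Bernstein n 0 x + (\<Sum>k\<le>n. g (Suc k) * Bernstein n (Suc k) x) =
      (\<Sum>k\<le>Suc n. g k * Bernstein n k x)"
    by (rule sum.atMost_Suc_shift [symmetric])
  also have "\<dots> = (\<Sum>k\<le>n. g k * Bernstein n k x)"
    by (simp add: Bernstein_def)
  finally show ?thesis .
qed

text \<open>The moment of order \<open>r\<close> for \<open>Suc n\<close> is a combination of the
  moments of order at most \<open>r\<close> for \<open>n\<close>, so all four formulas go through
  one simultaneous induction on \<open>n\<close>.\<close>

lemma Bernstein_central_moments:
  fixes x :: real
  defines "T \<equiv> \<lambda>n r. \<Sum>k\<le>n. (real k - real n * x) ^ r * Bernstein n k x"
  shows "T n 1 = 0" "T n 2 = n * (x * (1 - x))" "T n 3 = n * (x * (1 - x)) * (1 - 2 * x)"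
    "T n 4 = 3 * (real n)\<^sup>2 * (x * (1 - x))\<^sup>2 + n * (x * (1 - x)) * (1 - 6 * (x * (1 - x)))"
proof -
  have T0: "T n 0 = 1" for n
    by (simp add: T_def)
  \<comment> \<open>The centre moves from \<open>n * x\<close> to \<open>n * x + x\<close>, so a
    success changes the deviation by \<open>1 - x\<close> and a failure by
    \<open>- x\<close>.\<close>
  have shift: "T (Suc n) r = x * (\<Sum>k\<le>n. (real k - real n * x + (1 - x)) ^ r * Bernstein n k x) +
      (1 - x) * (\<Sum>k\<le>n. (real k - real n * x - x) ^ r * Bernstein n k x)" for n r
    unfolding T_def sum_Bernstein_Suc by (simp add: algebra_simps)
  have expand: "(\<Sum>k\<le>n. (real k - real n * x + c) ^ r * Bernstein n k x) =
      (\<Sum>i\<le>r. real (r choose i) * c ^ (r - i) * T n i)" for n r c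
    unfolding T_def binomial_ring sum_distrib_right sum_distrib_left
    by (subst sum.swap) (simp add: algebra_simps)
  have rec: "T (Suc n) r =
      x * (\<Sum>i\<le>r. real (r choose i) * (1 - x) ^ (r - i) * T n i) +
      (1 - x) * (\<Sum>i\<le>r. real (r choose i) * (- x) ^ (r - i) * T n i)" for n r
    using shift [of n r] expand [of n "1 - x" r] expand [of n "- x" r] by simp
  have "T n 1 = 0 \<and> T n 2 = n * (x * (1 - x)) \<and> T n 3 = n * (x * (1 - x)) * (1 - 2 * x) \<and>
    T n 4 = 3 * (real n)\<^sup>2 * (x * (1 - x))\<^sup>2 + n * (x * (1 - x)) * (1 - 6 * (x * (1 - x)))"
  proof (induction n)
    case 0
    then show ?case by (simp add: T_def)
  next
    case (Suc n)
    then have IH: "T n (Suc 0) = 0" "T n 2 = n * (x * (1 - x))"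
      "T n 3 = n * (x * (1 - x)) * (1 - 2 * x)"
      "T n 4 = 3 * (real n)\<^sup>2 * (x * (1 - x))\<^sup>2 + n * (x * (1 - x)) * (1 - 6 * (x * (1 - x)))"
      by simp_all
    have ch: "4 choose 2 = (6::nat)" "4 choose 3 = (4::nat)" "3 choose 2 = (3::nat)"
      by (simp_all add: eval_nat_numeral)
    have at: "{..1::nat} = {0, Suc 0}" "{..2::nat} = {0, Suc 0, 2}" "{..3::nat} = {0, Suc 0, 2, 3}"
      "{..4::nat} = {0, Suc 0, 2, 3, 4}" by auto
    show ?case
      unfolding rec at
      by (simp add: T0 IH ch) (intro conjI; algebra)
  qed
  then show "T n 1 = 0" "T n 2 = n * (x * (1 - x))" "T n 3 = n * (x * (1 - x)) * (1 - 2 * x)"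
    "T n 4 = 3 * (real n)\<^sup>2 * (x * (1 - x))\<^sup>2 + n * (x * (1 - x)) * (1 - 6 * (x * (1 - x)))"
    by blast+
qed

lemma mult_one_minus_le_quarter: "x * (1 - x) \<le> 1 / 4" for x :: real
proof -
  have "1 / 4 - x * (1 - x) = (x - 1 / 2)\<^sup>2"
    by (simp add: power2_eq_square field_simps)
  then show ?thesis
    by (metis diff_ge_0_iff_ge zero_le_power2)
qed

text \<open>With \<open>q = x * (1 - x)\<close> and \<open>n * q\<close> factored out, the claim
  becomes 1 + 3 (n - 2) q \<le> n. For n \<ge> 2 this follows from q \<le> 1/4; for n = 1 the
  coefficient of q is negative and q \<ge> 0 is used. One factor q is kept so that the error later
  vanishes at the endpoints like the main term.\<close>

lemma Bernstein_fourth_moment_le: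
  fixes x :: real
  assumes "0 \<le> x" "x \<le> 1" "n \<ge> 1"
  shows "(\<Sum>k\<le>n. (real k - real n * x) ^ 4 * Bernstein n k x) \<le> (real n)\<^sup>2 * (x * (1 - x))"
proof -
  define q where "q = x * (1 - x)"
  have q0: "0 \<le> q" using assms by (simp add: q_def)
  have q4: "q \<le> 1 / 4" unfolding q_def by (rule mult_one_minus_le_quarter)
  have "3 * n * q + (1 - 6 * q) \<le> n"
  proof (cases "n = 1")
    case True
    then show ?thesis using q0 by simp
  next
    case False
    with \<open>n \<ge> 1\<close> have "0 \<le> real n - 2" by simp
    then have "3 * (real n - 2) * q \<le> 3 * (real n - 2) * (1 / 4)"
      using q4 by (intro mult_left_mono) auto
    then show ?thesis using \<open>0 \<le> real n - 2\<close> by (simp add: algebra_simps)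
  qed
  then have "(n * q) * (3 * n * q + (1 - 6 * q)) \<le> (n * q) * n"
    using q0 by (intro mult_left_mono) auto
  then show ?thesis
    unfolding Bernstein_central_moments(4) q_def [symmetric]
    by (simp add: power2_eq_square algebra_simps)
qed

section \<open>Taylor estimates for Bernstein polynomials and second differences\<close>

lemma has_real_derivative_nth_deriv01:
  assumes "f \<in> Ck01 k" "j < k" "x \<in> {0..1}"
  shows "(nth_deriv01 j f has_real_derivative nth_deriv01 (Suc j) f x) (at x within {0..1})"
proof -
  have "nth_deriv01 j f differentiable (at x within {0..1})"
    using assms by (auto simp: Ck01_def differentiable_on_def)
  then show ?thesis
    by (simp add: vector_derivative_works has_real_derivative_iff_has_vector_derivative
        nth_deriv01_def)
qed

lemma abs_le_unif_norm:
  assumes "continuous_on {0..1} g" "x \<in> {0..1}"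
  shows "\<bar>g x\<bar> \<le> unif_norm g"
proof -
  have "compact ((\<lambda>x. \<bar>g x\<bar>) ` {0..1})"
    using assms(1) by (intro compact_continuous_image continuous_intros) auto
  then have "bdd_above ((\<lambda>x. \<bar>g x\<bar>) ` {0..1})"
    by (intro bounded_imp_bdd_above compact_imp_bounded)
  then show ?thesis
    unfolding unif_norm_def using assms(2) by (rule cSUP_upper2) simp
qed

lemma Taylor2_Ck01:
  assumes f: "f \<in> Ck01 3" and M: "\<And>y. y \<in> {0..1} \<Longrightarrow> \<bar>nth_deriv01 3 f y\<bar> \<le> M"
    and "x \<in> {0..1}" "t \<in> {0..1}"
  shows "\<bar>f t - (f x + nth_deriv01 1 f x * (t - x) + nth_deriv01 2 f x * (t - x)\<^sup>2 / 2)\<bar>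
           \<le> M / 2 * \<bar>t - x\<bar> ^ 3"
proof -
  \<comment> \<open>\<open>field_Taylor\<close> divides the remainder by 2! and not by the 3! of the
    Lagrange form, hence the constant \<open>M / 2\<close>.\<close>
  have "norm (nth_deriv01 0 f t - (\<Sum>i\<le>2. nth_deriv01 i f x * (t - x) ^ i / fact i))
      \<le> M * norm (t - x) ^ Suc 2 / fact 2"
    using assms by (intro field_Taylor [where S = "{0..1}"] has_real_derivative_nth_deriv01 [OF f])
      (auto simp: eval_nat_numeral)
  moreover have "{..2::nat} = {0, 1, 2}" by auto
  ultimately show ?thesis
    by (simp add: nth_deriv01_def add_ac)
qed

text \<open>The third absolute moment is controlled through \<open>2 \<bar>d\<bar>\<^sup>3 \<le> h d\<^sup>2 + d\<^sup>4 / h\<close>; the choice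
  \<open>h = 1 / sqrt n\<close> balances the two resulting moments.\<close>

lemma bernstein_op_Voronovskaja:
  assumes f: "f \<in> Ck01 3" and M: "\<And>y. y \<in> {0..1} \<Longrightarrow> \<bar>nth_deriv01 3 f y\<bar> \<le> M"
    and x: "x \<in> {0..1}" and n: "n \<ge> 1"
  shows "\<bar>bernstein_op n f x - f x - x * (1 - x) * nth_deriv01 2 f x / (2 * n)\<bar>
           \<le> M / 2 * (x * (1 - x)) / (n * sqrt n)"
proof -
  define s where "s = sqrt n"
  have s: "s > 0" "real n = s\<^sup>2" using n by (auto simp: s_def)
  define D where "D k = real k - real n * x" for k
  define P where "P k = Bernstein n k x" for k
  define a where "a = nth_deriv01 1 f x"
  define b where "b = nth_deriv01 2 f x"
  have M0: "0 \<le> M" using M [OF x] by simp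
  have P0: "0 \<le> P k" for k using x by (simp add: P_def Bernstein_nonneg)
  have S0: "(\<Sum>k\<le>n. P k) = 1" by (simp add: P_def)
  have S1: "(\<Sum>k\<le>n. D k * P k) = 0"
    using Bernstein_central_moments(1) [where n = n and x = x] by (simp add: D_def P_def)
  have S2: "(\<Sum>k\<le>n. (D k)\<^sup>2 * P k) = n * (x * (1 - x))"
    using Bernstein_central_moments(2) [where n = n and x = x] by (simp add: D_def P_def)
  have S4: "(\<Sum>k\<le>n. D k ^ 4 * P k) \<le> (real n)\<^sup>2 * (x * (1 - x))"
    using Bernstein_fourth_moment_le [of x n] x n by (simp add: D_def P_def)
  have Dn: "k / n - x = D k / n" for k using n by (simp add: D_def field_simps)
  define R where "R k = f (k / n) - (f x + a * (k / n - x) + b * (k / n - x)\<^sup>2 / 2)" for k :: nat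
  \<comment> \<open>The linear Taylor term drops out because the first central moment is zero; the
    quadratic one turns into the Voronovskaja term through the second moment.\<close>
  have sumR: "(\<Sum>k\<le>n. R k * P k) = bernstein_op n f x - f x - x * (1 - x) * b / (2 * n)"
  proof -
    have "(\<Sum>k\<le>n. R k * P k) = (\<Sum>k\<le>n. f (k / n) * P k - f x * P k - a / n * (D k * P k) -
        b / (2 * n\<^sup>2) * ((D k)\<^sup>2 * P k))"
      unfolding R_def Dn by (intro sum.cong refl) (simp add: power_divide algebra_simps)
    also have "\<dots> = (\<Sum>k\<le>n. f (k / n) * P k) - f x * (\<Sum>k\<le>n. P k) - a / n * (\<Sum>k\<le>n. D k * P k) -
        b / (2 * n\<^sup>2) * (\<Sum>k\<le>n. (D k)\<^sup>2 * P k)"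
      by (simp add: sum_subtractf sum_distrib_left)
    also have "\<dots> = bernstein_op n f x - f x - x * (1 - x) * b / (2 * n)"
      unfolding S0 S1 S2 using n by (simp add: bernstein_op_def P_def power2_eq_square)
    finally show ?thesis .
  qed
  have cube: "\<bar>d\<bar> ^ 3 \<le> (d\<^sup>2 / s + s * d ^ 4) / 2" for d :: real
  proof -
    have "0 \<le> d\<^sup>2 / s * (1 - s * \<bar>d\<bar>)\<^sup>2" using s by simp
    also have "\<dots> = d\<^sup>2 / s + s * (d\<^sup>2 * \<bar>d\<bar>\<^sup>2) - 2 * (d\<^sup>2 * \<bar>d\<bar>)"
      using s by (simp add: power2_eq_square field_simps)
    also have "\<dots> = d\<^sup>2 / s + s * d ^ 4 - 2 * \<bar>d\<bar> ^ 3"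
      by (simp add: eval_nat_numeral)
    finally show ?thesis by simp
  qed
  \<comment> \<open>The powers of \<open>s\<close> come from k/n - x = D k / s^2. After summation
    the moments s^2 q and s^4 q, with q = x (1 - x), make both terms contribute q / s^3.\<close>
  have "\<bar>R k\<bar> \<le> M / 4 * ((D k)\<^sup>2 / s ^ 5 + D k ^ 4 / s ^ 7)" if "k \<le> n" for k
  proof -
    have "\<bar>R k\<bar> \<le> M / 2 * \<bar>k / n - x\<bar> ^ 3"
      unfolding R_def a_def b_def using that n
      by (intro Taylor2_Ck01 [OF f M x]) auto
    also have "\<dots> \<le> M / 2 * (((k / n - x)\<^sup>2 / s + s * (k / n - x) ^ 4) / 2)"
      using M0 by (intro mult_left_mono cube) auto
    also have "\<dots> = M / 4 * ((D k)\<^sup>2 / s ^ 5 + D k ^ 4 / s ^ 7)"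
      unfolding Dn unfolding s(2) using s(1) by (simp add: field_simps eval_nat_numeral)
    finally show ?thesis .
  qed
  then have "(\<Sum>k\<le>n. \<bar>R k * P k\<bar>) \<le> (\<Sum>k\<le>n. M / 4 * ((D k)\<^sup>2 / s ^ 5 + D k ^ 4 / s ^ 7) * P k)"
    using P0 by (intro sum_mono) (simp only: abs_mult abs_of_nonneg mult_right_mono atMost_iff)
  also have "\<dots> = M / 4 * ((\<Sum>k\<le>n. (D k)\<^sup>2 * P k) / s ^ 5 + (\<Sum>k\<le>n. D k ^ 4 * P k) / s ^ 7)"
    by (simp add: sum_distrib_left sum_distrib_right sum_divide_distrib sum.distrib algebra_simps)
  also have "\<dots> \<le> M / 4 * ((n * (x * (1 - x))) / s ^ 5 + ((real n)\<^sup>2 * (x * (1 - x))) / s ^ 7)"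
    unfolding S2 using S4 M0 s(1) by (intro mult_left_mono add_mono divide_right_mono order_refl) auto
  also have "\<dots> = M / 2 * (x * (1 - x)) / (n * s)"
    unfolding s(2) using s(1) by (simp add: field_simps eval_nat_numeral)
  finally have "\<bar>\<Sum>k\<le>n. R k * P k\<bar> \<le> M / 2 * (x * (1 - x)) / (n * s)"
    using sum_abs [of "\<lambda>k. R k * P k" "{..n}"] by linarith
  then show ?thesis
    unfolding sumR by (simp add: b_def s_def)
qed

text \<open>Adding the Taylor expansions at \<open>x + s\<close> and \<open>x - s\<close> cancels
  the linear terms, and the two remainders \<open>M / 2 * \<bar>s\<bar> ^ 3\<close> add up.\<close>

lemma second_difference_Ck01:
  assumes f: "f \<in> Ck01 3" and M: "\<And>y. y \<in> {0..1} \<Longrightarrow> \<bar>nth_deriv01 3 f y\<bar> \<le> M"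
    and x: "x \<in> {0..1}" and s: "x + s \<in> {0..1}" "x - s \<in> {0..1}"
  shows "\<bar>f (x + s) - 2 * f x + f (x - s) - s\<^sup>2 * nth_deriv01 2 f x\<bar> \<le> M * \<bar>s\<bar> ^ 3"
proof -
  have *: "\<bar>u - 2 * v + w - b\<bar> \<le> c"
    if "\<bar>u - (v + a + b / 2)\<bar> \<le> c / 2" "\<bar>w - (v - a + b / 2)\<bar> \<le> c / 2" for a b c u v w :: real
    using that unfolding abs_le_iff by argo
  show ?thesis
    by (rule * [where a = "nth_deriv01 1 f x * s"])
       (use Taylor2_Ck01 [OF f M x s(1)] Taylor2_Ck01 [OF f M x s(2)] in \<open>simp_all add: mult.commute\<close>)
qed

section \<open>The step weight and the Ditzian-Totik modulus\<close>

lemma phi_squared: "x \<in> {0..1} \<Longrightarrow> (phi x)\<^sup>2 = x * (1 - x)"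
  by (simp add: phi_def)

lemma phi_nonneg: "x \<in> {0..1} \<Longrightarrow> 0 \<le> phi x"
  by (simp add: phi_def)

lemma phi_le_half: "phi x \<le> 1 / 2"
  unfolding phi_def
  by (rule real_le_lsqrt) (use mult_one_minus_le_quarter [of x] in \<open>auto simp: power2_eq_square\<close>)

text \<open>The lower bound on \<open>x\<close> rearranges to h^2 (1 - x) \<le> x; multiplied by x
  this reads (h phi(x))^2 \<le> x^2. The upper bound gives the same with 1 - x in place of
  x.\<close>

lemma phi_step_mem:
  assumes "x \<in> {h\<^sup>2 / (1 + h\<^sup>2)..1 / (1 + h\<^sup>2)}" "0 \<le> h"
  shows "x \<in> {0..1}" "x + h * phi x \<in> {0..1}" "x - h * phi x \<in> {0..1}"
proof -
  have p: "0 < 1 + h\<^sup>2" by (simp add: add_pos_nonneg)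
  have a: "h\<^sup>2 * (1 - x) \<le> x" "h\<^sup>2 * x \<le> 1 - x"
    using assms(1) p by (auto simp: field_simps)
  have "0 \<le> h\<^sup>2 / (1 + h\<^sup>2)" "1 / (1 + h\<^sup>2) \<le> 1" using p by auto
  then show x: "x \<in> {0..1}" using assms(1) unfolding atLeastAtMost_iff by linarith
  have "(h * phi x)\<^sup>2 = h\<^sup>2 * (1 - x) * x"
    by (simp add: power_mult_distrib phi_squared [OF x])
  also have "\<dots> \<le> x * x" using a x by (intro mult_right_mono) auto
  finally have 1: "h * phi x \<le> x"
    using x by (intro power2_le_imp_le [of "h * phi x" x]) (auto simp: power2_eq_square)
  have "(h * phi x)\<^sup>2 = h\<^sup>2 * x * (1 - x)"
    by (simp add: power_mult_distrib phi_squared [OF x])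
  also have "\<dots> \<le> (1 - x) * (1 - x)" using a x by (intro mult_right_mono) auto
  finally have 2: "h * phi x \<le> 1 - x"
    using x by (intro power2_le_imp_le [of "h * phi x" "1 - x"]) (auto simp: power2_eq_square)
  have "0 \<le> h * phi x" using assms(2) phi_nonneg [OF x] by simp
  then show "x + h * phi x \<in> {0..1}" "x - h * phi x \<in> {0..1}" using 1 2 x by auto
qed

lemma omega2_phi_interval_nonempty:
  fixes h :: real
  assumes "0 \<le> h" "h \<le> 1"
  shows "{h\<^sup>2 / (1 + h\<^sup>2)..1 / (1 + h\<^sup>2)} \<noteq> {}"
  using assms by (auto simp: power_le_one intro!: divide_right_mono)

lemma omega2_phi_le:
  assumes "0 \<le> \<delta>" "\<delta> \<le> 1"
    and "\<And>h x. 0 \<le> h \<Longrightarrow> h \<le> \<delta> \<Longrightarrow> x \<in> {h\<^sup>2 / (1 + h\<^sup>2)..1 / (1 + h\<^sup>2)} \<Longrightarrow>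
           \<bar>f (x + h * phi x) - 2 * f x + f (x - h * phi x)\<bar> \<le> C"
  shows "omega2_phi f \<delta> \<le> C"
  unfolding omega2_phi_def
proof (rule cSUP_least)
  show "{0..\<delta>} \<noteq> {}" using assms by simp
  fix h assume h: "h \<in> {0..\<delta>}"
  show "(SUP x\<in>{h\<^sup>2 / (1 + h\<^sup>2)..1 / (1 + h\<^sup>2)}.
      \<bar>f (x + h * phi x) - 2 * f x + f (x - h * phi x)\<bar>) \<le> C"
    using h assms by (intro cSUP_least omega2_phi_interval_nonempty) auto
qed

text \<open>The constant \<open>C\<close> only bounds the inner and outer families from above, so
  that both suprema in \<open>real\<close> dominate their members. The full step
  \<open>h = \<delta>\<close> is the one that matters, as the leading term of the second difference
  grows with \<open>h\<close>.\<close>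

lemma omega2_phi_ge:
  assumes "0 \<le> \<delta>" "\<delta> \<le> 1"
    and bound: "\<And>h x. 0 \<le> h \<Longrightarrow> h \<le> \<delta> \<Longrightarrow> x \<in> {h\<^sup>2 / (1 + h\<^sup>2)..1 / (1 + h\<^sup>2)} \<Longrightarrow>
           \<bar>f (x + h * phi x) - 2 * f x + f (x - h * phi x)\<bar> \<le> C"
    and x: "x \<in> {\<delta>\<^sup>2 / (1 + \<delta>\<^sup>2)..1 / (1 + \<delta>\<^sup>2)}"
  shows "\<bar>f (x + \<delta> * phi x) - 2 * f x + f (x - \<delta> * phi x)\<bar> \<le> omega2_phi f \<delta>"
proof -
  let ?D = "\<lambda>h x. \<bar>f (x + h * phi x) - 2 * f x + f (x - h * phi x)\<bar>"
  let ?S = "\<lambda>h. SUP x\<in>{h\<^sup>2 / (1 + h\<^sup>2)..1 / (1 + h\<^sup>2)}. ?D h x"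
  have "bdd_above (?D \<delta> ` {\<delta>\<^sup>2 / (1 + \<delta>\<^sup>2)..1 / (1 + \<delta>\<^sup>2)})"
    using bound [of \<delta>] assms(1) by (intro bdd_aboveI2) auto
  then have "?D \<delta> x \<le> ?S \<delta>" using x by (rule cSUP_upper2) simp
  moreover have "?S h \<le> C" if "h \<in> {0..\<delta>}" for h
    using that bound assms(2) by (intro cSUP_least omega2_phi_interval_nonempty) auto
  then have "bdd_above (?S ` {0..\<delta>})" by (rule bdd_aboveI2)
  then have "?S \<delta> \<le> omega2_phi f \<delta>"
    unfolding omega2_phi_def using assms(1) by (intro cSUP_upper) auto
  ultimately show ?thesis by linarith
qed

lemma nth_deriv01_Lipschitz:
  assumes "f \<in> Ck01 (Suc k)" "\<And>y. y \<in> {0..1} \<Longrightarrow> \<bar>nth_deriv01 (Suc k) f y\<bar> \<le> M"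
    and "x \<in> {0..1}" "y \<in> {0..1}"
  shows "\<bar>nth_deriv01 k f x - nth_deriv01 k f y\<bar> \<le> M * \<bar>x - y\<bar>"
  using field_differentiable_bound [of "{0..1}" "nth_deriv01 k f" "nth_deriv01 (Suc k) f" M x y]
    has_real_derivative_nth_deriv01 [OF assms(1)] assms
  by auto

lemma move_into_omega2_phi_interval:
  fixes h x :: real
  assumes h: "0 \<le> h" "h \<le> 1" and x: "x \<in> {0..1}"
  obtains y where "y \<in> {h\<^sup>2 / (1 + h\<^sup>2)..1 / (1 + h\<^sup>2)}" "\<bar>x - y\<bar> \<le> h\<^sup>2"
    "x * (1 - x) \<le> y * (1 - y)"
proof -
  define a where "a = h\<^sup>2 / (1 + h\<^sup>2)"
  have p: "0 < 1 + h\<^sup>2" by (simp add: add_pos_nonneg)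
  have b: "1 / (1 + h\<^sup>2) = 1 - a" using p by (simp add: a_def field_simps)
  have "a \<le> 1 / 2" using p h by (simp add: a_def field_simps power_le_one)
  have "0 \<le> a" by (simp add: a_def)
  have "a \<le> h\<^sup>2" using p by (simp add: a_def field_simps)
  consider "x < a" | "x \<in> {a..1 - a}" | "x > 1 - a" by fastforce
  then have "\<exists>y\<in>{a..1 - a}. \<bar>x - y\<bar> \<le> h\<^sup>2 \<and> x * (1 - x) \<le> y * (1 - y)"
  proof cases
    case 1
    \<comment> \<open>The product equals a (1 - a) - x (1 - x); the product in the third case is the
      same difference.\<close>
    then have "0 \<le> (a - x) * (1 - a - x)" using \<open>a \<le> 1 / 2\<close> by (intro mult_nonneg_nonneg) auto
    then show ?thesis using 1 x \<open>a \<le> 1 / 2\<close> \<open>a \<le> h\<^sup>2\<close>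
      by (intro bexI [of _ a]) (auto simp: algebra_simps)
  next
    case 2
    then show ?thesis by (intro bexI [of _ x]) auto
  next
    case 3
    then have "0 \<le> (x - (1 - a)) * (x - a)" using \<open>a \<le> 1 / 2\<close> by (intro mult_nonneg_nonneg) auto
    then show ?thesis using 3 x \<open>a \<le> 1 / 2\<close> \<open>a \<le> h\<^sup>2\<close>
      by (intro bexI [of _ "1 - a"]) (auto simp: algebra_simps)
  qed
  then show ?thesis using that unfolding b a_def [symmetric] by blast
qed

section \<open>Comparison of the uniform error with the modulus\<close>

lemma continuous_on_bernstein_op: "continuous_on S (bernstein_op n f)"
  unfolding bernstein_op_def [abs_def] Bernstein_def by (intro continuous_intros)

theorem corollary1:
  fixes m M :: real and f :: "real \<Rightarrow> real" and n :: nat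
  assumes "m > 0" and "M \<ge> 0"
    and "f \<in> C32 M m"
    and "n \<ge> 1" and "int n \<ge> \<lfloor>1024 * M\<^sup>2 / m\<^sup>2\<rfloor> + 1"
  shows "1 / 64 * omega2_phi f (1 / sqrt (real n)) \<le> unif_norm (\<lambda>x. f x - bernstein_op n f x) \<and>
         unif_norm (\<lambda>x. f x - bernstein_op n f x) \<le> 3 * omega2_phi f (1 / sqrt (real n))"
proof -
  define s where "s = sqrt n"
  have s: "s \<ge> 1" "real n = s\<^sup>2" using \<open>n \<ge> 1\<close> by (auto simp: s_def)
  define F where "F x = \<bar>nth_deriv01 2 f x\<bar>" for x
  define q where "q x = x * (1 - x)" for x :: real
  define N where "N = unif_norm (\<lambda>x. f x - bernstein_op n f x)"
  define \<Delta> where "\<Delta> h x = \<bar>f (x + h * phi x) - 2 * f x + f (x - h * phi x)\<bar>" for h x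
  have f: "f \<in> Ck01 3" and F: "\<And>x. x \<in> {0..1} \<Longrightarrow> m \<le> F x"
    using assms(3) by (auto simp: C32_def F_def)
  have M: "\<bar>nth_deriv01 3 f y\<bar> \<le> M" if "y \<in> {0..1}" for y
    using abs_le_unif_norm [of "nth_deriv01 3 f" y] f that assms(3) by (simp add: Ck01_def C32_def)
  have q0: "0 \<le> q x" if "x \<in> {0..1}" for x using that by (simp add: q_def)

  have Ms: "32 * M \<le> m * s"
  proof -
    \<comment> \<open>Exceeding the integer part by one puts \<open>n\<close> above the real
      quotient; as 1024 = 32^2, a square root then gives the claim.\<close>
    have "1024 * M\<^sup>2 / m\<^sup>2 \<le> s\<^sup>2" using assms(5) s(2) by linarith
    then have "(32 * M)\<^sup>2 \<le> (m * s)\<^sup>2" using \<open>m > 0\<close> by (simp add: field_simps power_mult_distrib)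
    then show ?thesis using \<open>m > 0\<close> s by (intro power2_le_imp_le [of "32 * M" "m * s"]) auto
  qed

  \<comment> \<open>The main term is 32/64 of \<open>q x * F x / n\<close>, and the Voronovskaja
    error is at most 1/64 of it.\<close>
  have B: "31 / 64 * (q x * F x / n) \<le> \<bar>f x - bernstein_op n f x\<bar>"
    "\<bar>f x - bernstein_op n f x\<bar> \<le> 33 / 64 * (q x * F x / n)" if x: "x \<in> {0..1}" for x
  proof -
    have "M / 2 * q x / (n * s) = (32 * M) * (q x / (64 * n * s))" using s by simp
    also have "\<dots> \<le> (m * s) * (q x / (64 * n * s))"
      using Ms q0 [OF x] s by (intro mult_right_mono) auto
    also have "\<dots> = m * (q x / (64 * n))" using s by simp
    also have "\<dots> \<le> F x * (q x / (64 * n))"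
      using F [OF x] q0 [OF x] by (intro mult_right_mono) auto
    finally have "\<bar>bernstein_op n f x - f x - q x * nth_deriv01 2 f x / (2 * n)\<bar>
        \<le> 1 / 64 * (q x * F x / n)"
      using bernstein_op_Voronovskaja [OF f M x \<open>n \<ge> 1\<close>] by (simp add: q_def s_def mult_ac)
    moreover have "\<bar>q x * nth_deriv01 2 f x / (2 * n)\<bar> = 1 / 2 * (q x * F x / n)"
      using q0 [OF x] by (simp add: F_def abs_mult)
    ultimately show "31 / 64 * (q x * F x / n) \<le> \<bar>f x - bernstein_op n f x\<bar>"
      "\<bar>f x - bernstein_op n f x\<bar> \<le> 33 / 64 * (q x * F x / n)"
      by linarith+
  qed

  have D: "63 / 64 * (h\<^sup>2 * (q x * F x)) \<le> \<Delta> h x" "\<Delta> h x \<le> 65 / 64 * (h\<^sup>2 * (q x * F x))"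
    if h: "0 \<le> h" "h \<le> 1 / s" and x': "x \<in> {h\<^sup>2 / (1 + h\<^sup>2)..1 / (1 + h\<^sup>2)}" for h x
  proof -
    note mem = phi_step_mem [OF x' h(1)]
    define t where "t = h * phi x"
    have t: "0 \<le> t" "t\<^sup>2 = h\<^sup>2 * q x"
      using h phi_nonneg [OF mem(1)] phi_squared [OF mem(1)]
      by (auto simp: t_def q_def power_mult_distrib)
    \<comment> \<open>The bound phi \<le> 1/2 halves M / s \<le> m / 32, so the relative error of
      the second difference is at most 1/64.\<close>
    have "t \<le> 1 / s * (1 / 2)"
      unfolding t_def using h s phi_le_half phi_nonneg [OF mem(1)] by (intro mult_mono) auto
    then have "M * t \<le> M * (1 / s * (1 / 2))" using \<open>M \<ge> 0\<close> by (rule mult_left_mono)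
    also have "\<dots> \<le> m / 64" using Ms s by (simp add: field_simps)
    also have "\<dots> \<le> F x / 64" using F [OF mem(1)] by simp
    finally have "(M * t) * t\<^sup>2 \<le> (F x / 64) * t\<^sup>2" by (rule mult_right_mono) simp
    then have "M * \<bar>t\<bar> ^ 3 \<le> 1 / 64 * (t\<^sup>2 * F x)"
      using t(1) by (simp add: eval_nat_numeral mult_ac)
    then have "\<bar>f (x + t) - 2 * f x + f (x - t) - t\<^sup>2 * nth_deriv01 2 f x\<bar> \<le> 1 / 64 * (t\<^sup>2 * F x)"
      using second_difference_Ck01 [OF f M mem(1), of t] mem(2,3) by (simp add: t_def)
    moreover have "\<bar>t\<^sup>2 * nth_deriv01 2 f x\<bar> = t\<^sup>2 * F x" by (simp add: F_def abs_mult)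
    moreover have "h\<^sup>2 * (q x * F x) = t\<^sup>2 * F x" using t(2) by simp
    ultimately show "63 / 64 * (h\<^sup>2 * (q x * F x)) \<le> \<Delta> h x"
      "\<Delta> h x \<le> 65 / 64 * (h\<^sup>2 * (q x * F x))"
      unfolding \<Delta>_def t_def [symmetric] by linarith+
  qed

  have le_N: "\<bar>f x - bernstein_op n f x\<bar> \<le> N" if "x \<in> {0..1}" for x
  proof -
    have "nth_deriv01 0 f differentiable_on {0..1}" using f by (auto simp: Ck01_def)
    then have "continuous_on {0..1} f"
      by (simp add: nth_deriv01_def differentiable_imp_continuous_on)
    then show ?thesis
      unfolding N_def using that
      by (intro abs_le_unif_norm continuous_intros continuous_on_bernstein_op) auto
  qed

  have s01: "0 \<le> 1 / s" "1 / s \<le> 1" using s by auto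
  have sq: "(1 / s)\<^sup>2 = 1 / n" using s by (simp add: power_divide)

  \<comment> \<open>The estimates \<open>D\<close> and \<open>B\<close> yield the factor 65/31, well
    within 64. Besides the lower estimate, this supplies the boundedness required by
    \<open>omega2_phi_ge\<close>.\<close>
  have bound: "\<Delta> h x \<le> 64 * N"
    if h: "0 \<le> h" "h \<le> 1 / s" and x: "x \<in> {h\<^sup>2 / (1 + h\<^sup>2)..1 / (1 + h\<^sup>2)}" for h x
  proof -
    note x01 = phi_step_mem(1) [OF x h(1)]
    have "h\<^sup>2 \<le> 1 / n" unfolding sq [symmetric] using h by (rule power_mono [rotated])
    then have "h\<^sup>2 * (q x * F x) \<le> 1 / n * (q x * F x)"
      using q0 [OF x01] by (intro mult_right_mono) (auto simp: F_def)
    then show ?thesis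
      using D(2) [OF h x] B(1) [OF x01] le_N [OF x01] by simp
  qed
  have "omega2_phi f (1 / s) \<le> 64 * N"
    using s01 bound unfolding \<Delta>_def by (rule omega2_phi_le)
  moreover have "N \<le> 3 * omega2_phi f (1 / s)"
    unfolding N_def unif_norm_def
  proof (rule cSUP_least)
    fix x :: real
    assume x: "x \<in> {0..1}"
    obtain y where y: "y \<in> {(1 / s)\<^sup>2 / (1 + (1 / s)\<^sup>2)..1 / (1 + (1 / s)\<^sup>2)}"
      "\<bar>x - y\<bar> \<le> (1 / s)\<^sup>2" "q x \<le> q y"
      using move_into_omega2_phi_interval [OF s01 x] unfolding q_def by metis
    note y01 = phi_step_mem(1) [OF y(1) s01(1)]
    have "F x \<le> F y + M * \<bar>x - y\<bar>"
      using nth_deriv01_Lipschitz [of f 2 M x y] f M x y01 by (simp add: F_def)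
    also have "M * \<bar>x - y\<bar> \<le> M * (1 / s)\<^sup>2" using y(2) \<open>M \<ge> 0\<close> by (rule mult_left_mono)
    \<comment> \<open>One power of 1/s is given up here so that \<open>Ms\<close> applies.\<close>
    also have "\<dots> \<le> M * (1 / s)"
      using power_decreasing [of 1 2 "1 / s"] s01 \<open>M \<ge> 0\<close> by (intro mult_left_mono) auto
    also have "\<dots> \<le> m / 32" using Ms s by (simp add: field_simps)
    also have "\<dots> \<le> F y / 32" using F [OF y01] by simp
    finally have "F x \<le> 33 / 32 * F y" by simp
    then have "q x * F x \<le> q y * (33 / 32 * F y)"
      using y(3) q0 [OF y01] by (intro mult_mono) (auto simp: F_def)
    then have "q x * F x / n \<le> (33 / 32 * (q y * F y)) / n"
      by (intro divide_right_mono) auto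
    moreover have "0 \<le> q y * F y / n" using q0 [OF y01] by (simp add: F_def)
    moreover have "63 / 64 * (q y * F y / n) \<le> \<Delta> (1 / s) y"
      using D(1) [OF s01(1) order_refl y(1)] unfolding sq by simp
    moreover have "\<Delta> (1 / s) y \<le> omega2_phi f (1 / s)"
      using s01 bound y(1) unfolding \<Delta>_def by (rule omega2_phi_ge)
    \<comment> \<open>The factors combine to (33/64) (33/32) (64/63), which is below 3.\<close>
    ultimately show "\<bar>f x - bernstein_op n f x\<bar> \<le> 3 * omega2_phi f (1 / s)"
      using B(2) [OF x] by (simp add: field_simps)
  qed simp
  ultimately show ?thesis by (simp add: N_def s_def)
qed

end
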